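(* Let $\mathcal C$ be a dagger category whose objects are orthosets of at most countable rank, whose morphisms are maps between them, and whose dagger assigns to each morphism an adjoint of it, and assume that $\mathcal C$ contains an orthoset of non-zero rank. Assume that: (H1) $\mathcal C$ has dagger biproducts. (H2) For every $X\in\mathcal C$ and every subspace $A$ of $X$, the orthosets $A$, $A^\perp$ and the inclusion maps $\iota_A\colon A\to X$, $\iota_{A^\perp}\colon A^\perp\to X$ belong to $\mathcal C$, and $A\xrightarrow{\iota_A}X\xleftarrow{\iota_{A^\perp}}A^\perp$ is a dagger biproduct of $A$ and $A^\perp$. (H3') Any non-zero morphism between unital orthosets in $\mathcal C$ is an isomorphism. (H4) For any two objects $X,Y\in\mathcal C$ there is a dagger monomorphism from $X$ to $Y$ or from $Y$ to $X$. Let the $\ast$-sfield $F$ and the functor $\mathsf L\colon\mathcal C\to\mathcal{OMS}_F$ be as constructed in the context. Then $\mathsf L$ is faithful.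
   Context: Orthosets: An orthoset is a non-empty set $X$ with a binary relation $\perp$ and a constant $0\in X$ such that $x\perp y$ implies $y\perp x$, $x\perp x$ only if $x=0$, and $0\perp x$ for all $x\in X$. An element $\neq 0$ is called proper. For $A\subseteq X$ put $A^\perp=\{x\in X: x\perp y\text{ for all }y\in A\}$; $A$ is orthoclosed if $A^{\perp\perp}=A$. A subspace of $X$ is an orthoclosed subset with the restricted relation and the same $0$ (again an orthoset). The rank of $X$ is the supremum of the cardinalities of sets of mutually orthogonal proper elements. $X$ is unital if there is a proper $z\in X$ such that no proper element of $X$ is orthogonal to $z$. A map $g\colon Y\to X$ is an adjoint of $f\colon X\to Y$ if for all $x\in X,y\in Y$: $f(x)\perp y$ iff $x\perp g(y)$. Write $x\parallel y$ if $\{x\}^\perp=\{y\}^\perp$, $[x]$ for the $\parallel$-class of $x$, and $P(X)=\{[x]:x\in X\}$, an orthoset with $[x]\perp[y]$ iff $x\perp y$ and constant $[0]$. A map $f\colon X\to Y$ possessing an adjoint preserves $\parallel$ and induces $P(f)\colon P(X)\to P(Y)$, $[x]\mapsto[f(x)]$. An orthoisomorphism is a bijection between orthosets preserving and reflecting $\perp$. Dagger categories: A dagger on a category is an involutive functor $^\ast\colon\mathcal C^{op}\to\mathcal C$ that is the identity on objects. A morphism $f\colon A\to B$ is an isometry (dagger monomorphism) if $f^\ast\circ f=\mathrm{id}_A$, a dagger isomorphism if moreover $f\circ f^\ast=\mathrm{id}_B$. If there is a zero object $0$, the zero map $0_{A,B}\colon A\to B$ is the unique morphism factoring through $0$. A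 dagger biproduct of $A,B$ is a coproduct $A\xrightarrow{\iota_A}A\oplus B\xleftarrow{\iota_B}B$ with $\iota_A,\iota_B$ dagger monomorphisms and $\iota_B^\ast\circ\iota_A=0_{A,B}$; for $f\colon A\to C$, $g\colon B\to D$, $f\oplus g$ is the unique morphism with $(f\oplus g)\circ\iota_A=\iota_C\circ f$, $(f\oplus g)\circ\iota_B=\iota_D\circ g$. "$\mathcal C$ has dagger biproducts" means that $\mathcal C$ has a zero object and every pair of objects has a dagger biproduct. Orthomodular spaces: A $\ast$-sfield is a skew field with an involutory antiautomorphism $^\ast$. A Hermitian space over a $\ast$-sfield $F$ is a (left) linear space $H$ over $F$ with a map $(\cdot,\cdot)\colon H\times H\to F$ that is linear in the first argument, satisfies $(w,\alpha u+\beta v)=(w,u)\alpha^\ast+(w,v)\beta^\ast$ and $(u,v)=(v,u)^\ast$, and is anisotropic ($(u,u)=0$ implies $u=0$); it is an orthoset with $u\perp v$ iff $(u,v)=0$ and constant the zero vector, and is assumed to contain at most countably many pairwise orthogonal non-zero vectors. Its dimension is the cardinality of any maximal set of pairwise orthogonal non-zero vectors. A subspace of $H$ is an orthoclosed subset with the restricted linear structure and form. $H$ is orthomodular if $H=S+S^\perp$ for every subspace $S$, and uniform if each $1$-dimensional subspace contains a vector $u$ with $(u,u)=1$. A linear adjoint of a linear map $\phi\colon H_1\to H_2$ is a map $\phi^\ast\colon H_2\to H_1$ with $(\phi(u),v)=(u,\phi^\ast(v))$ for all $u,v$; a linear map is adjointable if it has a linear adjoint. A linear map $\phi$ induces $P(\phi)\colon[u]\mapsto[\phi(u)]$.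 $\mathcal{OMS}_F$ is the dagger category of uniform orthomodular spaces over $F$, adjointable linear maps, and the linear adjoint as dagger. Construction of $F$ and $\mathsf L$: Fix $Z\in\mathcal C$ of rank $3$, a $3$-dimensional uniform orthomodular space $H^Z$ and an orthoisomorphism $r\colon P(Z)\to P(H^Z)$; $F$ is the scalar $\ast$-sfield of $H^Z$. For each $X\in\mathcal C$ take the dagger biproduct $X\xrightarrow{\iota_X}X\oplus Z\xleftarrow{\iota_Z}Z$ and choose a uniform orthomodular space $\overline{H_X}$ over $F$ containing $H^Z$ as a subspace together with an orthoisomorphism $\bar r_X\colon P(X\oplus Z)\to P(\overline{H_X})$ such that $\bar r_X\circ P(\iota_Z)=P(\iota_{H^Z})\circ r$, where $\iota_{H^Z}\colon H^Z\to\overline{H_X}$ is the inclusion. Let $H_X$ be the orthocomplement of $H^Z$ in $\overline{H_X}$, so $\overline{H_X}=H_X\oplus H^Z$, and let $r_X\colon P(X)\to P(H_X)$ be the orthoisomorphism with $\bar r_X\circ P(\iota_X)=P(\iota_{H_X})\circ r_X$. Put $\mathsf L(X)=H_X$. For a morphism $f\colon X\to Y$, $\mathsf L(f)$ is the unique linear map $\phi\colon H_X\to H_Y$ such that $\bar r_Y\circ P(f\oplus\mathrm{id}_Z)=P(\phi\oplus\mathrm{id}_{H^Z})\circ\bar r_X$. (Such choices exist, $\phi$ exists uniquely, and $\mathsf L$ is a dagger functor.) *)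

theory Defs
  imports "HOL-Algebra.AbelCoset" "HOL-Algebra.Module"
    "HOL-Library.Extended_Nat" "HOL-Library.Countable_Set" "HOL-Library.FuncSet"
begin

section \<open>Orthosets\<close>

record 'a orthoset = "'a partial_object" +
  orth :: "'a \<Rightarrow> 'a \<Rightarrow> bool"
  ozero :: 'a

text \<open>The relation is required to live on the carrier, so that two orthosets are equal as
  records exactly if they are equal as mathematical structures.\<close>

locale orthoset =
  fixes X :: "'a orthoset"
  assumes orth_carrier: "orth X x y \<Longrightarrow> x \<in> carrier X \<and> y \<in> carrier X"
    and zero_closed: "ozero X \<in> carrier X"
    and orth_sym: "orth X x y \<Longrightarrow> orth X y x"
    and orth_self: "orth X x x \<Longrightarrow> x = ozero X"
    and orth_zero: "x \<in> carrier X \<Longrightarrow> orth X (ozero X) x"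

definition proper :: "'a orthoset \<Rightarrow> 'a \<Rightarrow> bool" where
  "proper X x \<longleftrightarrow> x \<in> carrier X \<and> x \<noteq> ozero X"

definition perp :: "'a orthoset \<Rightarrow> 'a set \<Rightarrow> 'a set" where
  "perp X A = {x \<in> carrier X. \<forall>y\<in>A. orth X x y}"

definition orthoclosed :: "'a orthoset \<Rightarrow> 'a set \<Rightarrow> bool" where
  "orthoclosed X A \<longleftrightarrow> A \<subseteq> carrier X \<and> perp X (perp X A) = A"

definition sub_orthoset :: "'a orthoset \<Rightarrow> 'a set \<Rightarrow> 'a orthoset" where
  "sub_orthoset X A =
     \<lparr>carrier = A, orth = (\<lambda>x y. x \<in> A \<and> y \<in> A \<and> orth X x y), ozero = ozero X\<rparr>"

definition incl :: "'a set \<Rightarrow> 'a \<Rightarrow> 'a" where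
  "incl A = (\<lambda>x\<in>A. x)"

definition orthogonal_set :: "'a orthoset \<Rightarrow> 'a set \<Rightarrow> bool" where
  "orthogonal_set X A \<longleftrightarrow> (\<forall>x\<in>A. proper X x) \<and> (\<forall>x\<in>A. \<forall>y\<in>A. x \<noteq> y \<longrightarrow> orth X x y)"

text \<open>The type \<^typ>\<open>enat\<close> does not distinguish infinite cardinals; that the rank is at most
  countable is therefore a separate predicate.\<close>

definition rank :: "'a orthoset \<Rightarrow> enat" where
  "rank X = (SUP A \<in> {A. orthogonal_set X A}. if finite A then enat (card A) else \<infinity>)"

definition countable_rank :: "'a orthoset \<Rightarrow> bool" where
  "countable_rank X \<longleftrightarrow> (\<forall>A. orthogonal_set X A \<longrightarrow> countable A)"

definition unital :: "'a orthoset \<Rightarrow> bool" where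
  "unital X \<longleftrightarrow> (\<exists>z. proper X z \<and> (\<forall>x. proper X x \<longrightarrow> \<not> orth X x z))"

definition is_adjoint :: "'a orthoset \<Rightarrow> 'b orthoset \<Rightarrow> ('a \<Rightarrow> 'b) \<Rightarrow> ('b \<Rightarrow> 'a) \<Rightarrow> bool" where
  "is_adjoint X Y f g \<longleftrightarrow> g \<in> carrier Y \<rightarrow> carrier X \<and>
     (\<forall>x\<in>carrier X. \<forall>y\<in>carrier Y. orth Y (f x) y \<longleftrightarrow> orth X x (g y))"

definition parallel :: "'a orthoset \<Rightarrow> 'a \<Rightarrow> 'a \<Rightarrow> bool" where
  "parallel X x y \<longleftrightarrow> perp X {x} = perp X {y}"

definition pclass :: "'a orthoset \<Rightarrow> 'a \<Rightarrow> 'a set" where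
  "pclass X x = {y \<in> carrier X. parallel X x y}"

definition proj :: "'a orthoset \<Rightarrow> 'a set orthoset" where
  "proj X =
     \<lparr>carrier = pclass X ` carrier X,
      orth = (\<lambda>c d. \<exists>x\<in>carrier X. \<exists>y\<in>carrier X.
                c = pclass X x \<and> d = pclass X y \<and> orth X x y),
      ozero = pclass X (ozero X)\<rparr>"

text \<open>Meaningful only if \<open>f\<close> preserves \<^const>\<open>parallel\<close>: then the image below is a singleton.\<close>

definition proj_map :: "'b orthoset \<Rightarrow> ('a \<Rightarrow> 'b) \<Rightarrow> 'a set \<Rightarrow> 'b set" where
  "proj_map Y f c = the_elem ((\<lambda>x. pclass Y (f x)) ` c)"

definition orthoiso :: "'a orthoset \<Rightarrow> 'b orthoset \<Rightarrow> ('a \<Rightarrow> 'b) \<Rightarrow> bool" where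
  "orthoiso X Y f \<longleftrightarrow> bij_betw f (carrier X) (carrier Y) \<and>
     (\<forall>x\<in>carrier X. \<forall>y\<in>carrier X. orth X x y \<longleftrightarrow> orth Y (f x) (f y))"


section \<open>Dagger categories\<close>

text \<open>Hom-sets need not be disjoint, so composition and dagger take the objects as arguments:
  \<open>Cmp C X Y Z g f\<close> is the composite of \<open>f : X \<rightarrow> Y\<close> and \<open>g : Y \<rightarrow> Z\<close>.\<close>

record ('o, 'm) dagger_cat =
  Obj :: "'o set"
  Hom :: "'o \<Rightarrow> 'o \<Rightarrow> 'm set"
  Cmp :: "'o \<Rightarrow> 'o \<Rightarrow> 'o \<Rightarrow> 'm \<Rightarrow> 'm \<Rightarrow> 'm"
  Idt :: "'o \<Rightarrow> 'm"
  Dag :: "'o \<Rightarrow> 'o \<Rightarrow> 'm \<Rightarrow> 'm"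

locale dagger_category =
  fixes C :: "('o, 'm) dagger_cat"
  assumes Idt_in: "X \<in> Obj C \<Longrightarrow> Idt C X \<in> Hom C X X"
    and Cmp_in: "\<lbrakk>X \<in> Obj C; Y \<in> Obj C; Z \<in> Obj C; f \<in> Hom C X Y; g \<in> Hom C Y Z\<rbrakk>
      \<Longrightarrow> Cmp C X Y Z g f \<in> Hom C X Z"
    and Cmp_Idt_right: "\<lbrakk>X \<in> Obj C; Y \<in> Obj C; f \<in> Hom C X Y\<rbrakk>
      \<Longrightarrow> Cmp C X X Y f (Idt C X) = f"
    and Cmp_Idt_left: "\<lbrakk>X \<in> Obj C; Y \<in> Obj C; f \<in> Hom C X Y\<rbrakk>
      \<Longrightarrow> Cmp C X Y Y (Idt C Y) f = f"
    and Cmp_assoc: "\<lbrakk>W \<in> Obj C; X \<in> Obj C; Y \<in> Obj C; Z \<in> Obj C;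
        f \<in> Hom C W X; g \<in> Hom C X Y; h \<in> Hom C Y Z\<rbrakk>
      \<Longrightarrow> Cmp C W Y Z h (Cmp C W X Y g f) = Cmp C W X Z (Cmp C X Y Z h g) f"
    and Dag_in: "\<lbrakk>X \<in> Obj C; Y \<in> Obj C; f \<in> Hom C X Y\<rbrakk> \<Longrightarrow> Dag C X Y f \<in> Hom C Y X"
    and Dag_Dag: "\<lbrakk>X \<in> Obj C; Y \<in> Obj C; f \<in> Hom C X Y\<rbrakk>
      \<Longrightarrow> Dag C Y X (Dag C X Y f) = f"
    and Dag_Idt: "X \<in> Obj C \<Longrightarrow> Dag C X X (Idt C X) = Idt C X"
    and Dag_Cmp: "\<lbrakk>X \<in> Obj C; Y \<in> Obj C; Z \<in> Obj C; f \<in> Hom C X Y; g \<in> Hom C Y Z\<rbrakk>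
      \<Longrightarrow> Dag C X Z (Cmp C X Y Z g f) = Cmp C Z Y X (Dag C X Y f) (Dag C Y Z g)"

definition isomorphism :: "('o, 'm) dagger_cat \<Rightarrow> 'o \<Rightarrow> 'o \<Rightarrow> 'm \<Rightarrow> bool" where
  "isomorphism C X Y f \<longleftrightarrow> f \<in> Hom C X Y \<and>
     (\<exists>g\<in>Hom C Y X. Cmp C X Y X g f = Idt C X \<and> Cmp C Y X Y f g = Idt C Y)"

definition dagger_mono :: "('o, 'm) dagger_cat \<Rightarrow> 'o \<Rightarrow> 'o \<Rightarrow> 'm \<Rightarrow> bool" where
  "dagger_mono C X Y f \<longleftrightarrow> f \<in> Hom C X Y \<and> Cmp C X Y X (Dag C X Y f) f = Idt C X"

definition zero_object :: "('o, 'm) dagger_cat \<Rightarrow> 'o \<Rightarrow> bool" where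
  "zero_object C N \<longleftrightarrow> N \<in> Obj C \<and>
     (\<forall>X\<in>Obj C. (\<exists>!f. f \<in> Hom C X N) \<and> (\<exists>!f. f \<in> Hom C N X))"

definition zero_morphism :: "('o, 'm) dagger_cat \<Rightarrow> 'o \<Rightarrow> 'o \<Rightarrow> 'm \<Rightarrow> bool" where
  "zero_morphism C X Y f \<longleftrightarrow>
     (\<exists>N. zero_object C N \<and> (\<exists>g\<in>Hom C X N. \<exists>h\<in>Hom C N Y. f = Cmp C X N Y h g))"

record ('o, 'm) cospan =
  Apex :: 'o
  Inl :: 'm
  Inr :: 'm

definition coproduct :: "('o, 'm) dagger_cat \<Rightarrow> 'o \<Rightarrow> 'o \<Rightarrow> ('o, 'm) cospan \<Rightarrow> bool" where
  "coproduct C A B S \<longleftrightarrow>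
     A \<in> Obj C \<and> B \<in> Obj C \<and> Apex S \<in> Obj C \<and>
     Inl S \<in> Hom C A (Apex S) \<and> Inr S \<in> Hom C B (Apex S) \<and>
     (\<forall>X\<in>Obj C. \<forall>f\<in>Hom C A X. \<forall>g\<in>Hom C B X.
        \<exists>!h. h \<in> Hom C (Apex S) X \<and>
          Cmp C A (Apex S) X h (Inl S) = f \<and> Cmp C B (Apex S) X h (Inr S) = g)"

definition dagger_biproduct :: "('o, 'm) dagger_cat \<Rightarrow> 'o \<Rightarrow> 'o \<Rightarrow> ('o, 'm) cospan \<Rightarrow> bool" where
  "dagger_biproduct C A B S \<longleftrightarrow> coproduct C A B S \<and>
     dagger_mono C A (Apex S) (Inl S) \<and> dagger_mono C B (Apex S) (Inr S) \<and>
     zero_morphism C A B (Cmp C A (Apex S) B (Dag C B (Apex S) (Inr S)) (Inl S))"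

definition has_dagger_biproducts :: "('o, 'm) dagger_cat \<Rightarrow> bool" where
  "has_dagger_biproducts C \<longleftrightarrow> (\<exists>N. zero_object C N) \<and>
     (\<forall>A\<in>Obj C. \<forall>B\<in>Obj C. \<exists>S. dagger_biproduct C A B S)"

text \<open>\<open>f \<oplus> g : A \<oplus> B \<rightarrow> A' \<oplus> B'\<close> for \<open>f : A \<rightarrow> A'\<close> and \<open>g : B \<rightarrow> B'\<close>, where \<open>S\<close> and \<open>S'\<close> are
  the chosen biproducts.\<close>

definition sum_morphism ::
  "('o, 'm) dagger_cat \<Rightarrow> 'o \<Rightarrow> 'o \<Rightarrow> ('o, 'm) cospan \<Rightarrow> 'o \<Rightarrow> 'o \<Rightarrow> ('o, 'm) cospan
    \<Rightarrow> 'm \<Rightarrow> 'm \<Rightarrow> 'm" where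
  "sum_morphism C A B S A' B' S' f g =
     (THE h. h \<in> Hom C (Apex S) (Apex S') \<and>
        Cmp C A (Apex S) (Apex S') h (Inl S) = Cmp C A A' (Apex S') (Inl S') f \<and>
        Cmp C B (Apex S) (Apex S') h (Inr S) = Cmp C B B' (Apex S') (Inr S') g)"

record ('o, 'm, 'p, 'n) cfunctor =
  Fobj :: "'o \<Rightarrow> 'p"
  Fmor :: "'o \<Rightarrow> 'o \<Rightarrow> 'm \<Rightarrow> 'n"

locale dagger_functor =
  source: dagger_category C + target: dagger_category D
  for C :: "('o, 'm) dagger_cat" and D :: "('p, 'n) dagger_cat" +
  fixes L :: "('o, 'm, 'p, 'n) cfunctor"
  assumes Fobj_in: "X \<in> Obj C \<Longrightarrow> Fobj L X \<in> Obj D"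
    and Fmor_in: "\<lbrakk>X \<in> Obj C; Y \<in> Obj C; f \<in> Hom C X Y\<rbrakk>
      \<Longrightarrow> Fmor L X Y f \<in> Hom D (Fobj L X) (Fobj L Y)"
    and Fmor_Idt: "X \<in> Obj C \<Longrightarrow> Fmor L X X (Idt C X) = Idt D (Fobj L X)"
    and Fmor_Cmp: "\<lbrakk>X \<in> Obj C; Y \<in> Obj C; Z \<in> Obj C; f \<in> Hom C X Y; g \<in> Hom C Y Z\<rbrakk>
      \<Longrightarrow> Fmor L X Z (Cmp C X Y Z g f) =
          Cmp D (Fobj L X) (Fobj L Y) (Fobj L Z) (Fmor L Y Z g) (Fmor L X Y f)"
    and Fmor_Dag: "\<lbrakk>X \<in> Obj C; Y \<in> Obj C; f \<in> Hom C X Y\<rbrakk>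
      \<Longrightarrow> Fmor L Y X (Dag C X Y f) = Dag D (Fobj L X) (Fobj L Y) (Fmor L X Y f)"

definition faithful :: "('o, 'm) dagger_cat \<Rightarrow> ('o, 'm, 'p, 'n) cfunctor \<Rightarrow> bool" where
  "faithful C L \<longleftrightarrow> (\<forall>X\<in>Obj C. \<forall>Y\<in>Obj C. inj_on (Fmor L X Y) (Hom C X Y))"

text \<open>Maps between orthosets are represented by functions that are \<^const>\<open>undefined\<close> outside
  the carrier of their domain, so that equality of morphisms is equality of maps.\<close>

locale orthoset_category = dagger_category C
  for C :: "('a orthoset, 'a \<Rightarrow> 'a) dagger_cat" +
  assumes Obj_orthoset: "X \<in> Obj C \<Longrightarrow> orthoset X"
    and Obj_countable_rank: "X \<in> Obj C \<Longrightarrow> countable_rank X"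
    and Hom_map: "\<lbrakk>X \<in> Obj C; Y \<in> Obj C\<rbrakk> \<Longrightarrow> Hom C X Y \<subseteq> carrier X \<rightarrow>\<^sub>E carrier Y"
    and Idt_eq: "X \<in> Obj C \<Longrightarrow> Idt C X = (\<lambda>x\<in>carrier X. x)"
    and Cmp_eq: "\<lbrakk>X \<in> Obj C; Y \<in> Obj C; Z \<in> Obj C; f \<in> Hom C X Y; g \<in> Hom C Y Z\<rbrakk>
      \<Longrightarrow> Cmp C X Y Z g f = compose (carrier X) g f"
    and Dag_adjoint: "\<lbrakk>X \<in> Obj C; Y \<in> Obj C; f \<in> Hom C X Y\<rbrakk>
      \<Longrightarrow> is_adjoint X Y f (Dag C X Y f)"


section \<open>Orthomodular spaces\<close>

record 'f star_ring = "'f ring" +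
  star :: "'f \<Rightarrow> 'f"

locale star_sfield = ring F for F :: "'f star_ring" (structure) +
  assumes sfield_Units: "Units F = carrier F - {\<zero>}"
    and star_closed: "a \<in> carrier F \<Longrightarrow> star F a \<in> carrier F"
    and star_add: "\<lbrakk>a \<in> carrier F; b \<in> carrier F\<rbrakk> \<Longrightarrow> star F (a \<oplus> b) = star F a \<oplus> star F b"
    and star_mult: "\<lbrakk>a \<in> carrier F; b \<in> carrier F\<rbrakk> \<Longrightarrow> star F (a \<otimes> b) = star F b \<otimes> star F a"
    and star_star: "a \<in> carrier F \<Longrightarrow> star F (star F a) = a"

record ('f, 'v) hspace = "('f, 'v) module" +
  form :: "'v \<Rightarrow> 'v \<Rightarrow> 'f"

definition horthoset :: "('f, 'm) ring_scheme \<Rightarrow> ('f, 'v) hspace \<Rightarrow> 'v orthoset" where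
  "horthoset F H =
     \<lparr>carrier = carrier H,
      orth = (\<lambda>u v. u \<in> carrier H \<and> v \<in> carrier H \<and> form H u v = \<zero>\<^bsub>F\<^esub>),
      ozero = \<zero>\<^bsub>H\<^esub>\<rparr>"

text \<open>The locale \<^locale>\<open>module\<close> cannot be used for the linear structure because it requires
  commutative scalars. The multiplication and unit that the record of vectors inherits from
  rings play no role.\<close>

locale hermitian_space = star_sfield F + V: abelian_group H
  for F :: "'f star_ring" (structure) and H :: "('f, 'v) hspace" +
  assumes smult_closed: "\<lbrakk>a \<in> carrier F; u \<in> carrier H\<rbrakk> \<Longrightarrow> a \<odot>\<^bsub>H\<^esub> u \<in> carrier H"
    and smult_l_distr: "\<lbrakk>a \<in> carrier F; b \<in> carrier F; u \<in> carrier H\<rbrakk>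
      \<Longrightarrow> (a \<oplus> b) \<odot>\<^bsub>H\<^esub> u = a \<odot>\<^bsub>H\<^esub> u \<oplus>\<^bsub>H\<^esub> b \<odot>\<^bsub>H\<^esub> u"
    and smult_r_distr: "\<lbrakk>a \<in> carrier F; u \<in> carrier H; v \<in> carrier H\<rbrakk>
      \<Longrightarrow> a \<odot>\<^bsub>H\<^esub> (u \<oplus>\<^bsub>H\<^esub> v) = a \<odot>\<^bsub>H\<^esub> u \<oplus>\<^bsub>H\<^esub> a \<odot>\<^bsub>H\<^esub> v"
    and smult_assoc: "\<lbrakk>a \<in> carrier F; b \<in> carrier F; u \<in> carrier H\<rbrakk>
      \<Longrightarrow> (a \<otimes> b) \<odot>\<^bsub>H\<^esub> u = a \<odot>\<^bsub>H\<^esub> (b \<odot>\<^bsub>H\<^esub> u)"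
    and smult_one: "u \<in> carrier H \<Longrightarrow> \<one> \<odot>\<^bsub>H\<^esub> u = u"
    and form_closed: "\<lbrakk>u \<in> carrier H; v \<in> carrier H\<rbrakk> \<Longrightarrow> form H u v \<in> carrier F"
    and form_linear_left: "\<lbrakk>a \<in> carrier F; b \<in> carrier F;
        u \<in> carrier H; v \<in> carrier H; w \<in> carrier H\<rbrakk>
      \<Longrightarrow> form H (a \<odot>\<^bsub>H\<^esub> u \<oplus>\<^bsub>H\<^esub> b \<odot>\<^bsub>H\<^esub> v) w = a \<otimes> form H u w \<oplus> b \<otimes> form H v w"
    and form_semilinear_right: "\<lbrakk>a \<in> carrier F; b \<in> carrier F;
        u \<in> carrier H; v \<in> carrier H; w \<in> carrier H\<rbrakk>
      \<Longrightarrow> form H w (a \<odot>\<^bsub>H\<^esub> u \<oplus>\<^bsub>H\<^esub> b \<odot>\<^bsub>H\<^esub> v) = form H w u \<otimes> star F a \<oplus> form H w v \<otimes> star F b"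
    and form_hermitian: "\<lbrakk>u \<in> carrier H; v \<in> carrier H\<rbrakk> \<Longrightarrow> form H u v = star F (form H v u)"
    and form_anisotropic: "\<lbrakk>u \<in> carrier H; form H u u = \<zero>\<rbrakk> \<Longrightarrow> u = \<zero>\<^bsub>H\<^esub>"
    and countably_many_orthogonal: "countable_rank (horthoset F H)"

definition maximal_orthogonal_set :: "'a orthoset \<Rightarrow> 'a set \<Rightarrow> bool" where
  "maximal_orthogonal_set X B \<longleftrightarrow> orthogonal_set X B \<and>
     (\<forall>B'. orthogonal_set X B' \<and> B \<subseteq> B' \<longrightarrow> B' = B)"

definition has_dimension :: "('f, 'm) ring_scheme \<Rightarrow> ('f, 'v) hspace \<Rightarrow> nat \<Rightarrow> bool" where
  "has_dimension F H n \<longleftrightarrow>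
     (\<forall>B. maximal_orthogonal_set (horthoset F H) B \<longrightarrow> finite B \<and> card B = n)"

definition sub_hspace :: "('f, 'v) hspace \<Rightarrow> 'v set \<Rightarrow> ('f, 'v) hspace" where
  "sub_hspace H A = H\<lparr>carrier := A\<rparr>"

text \<open>\<open>K\<close> is a subspace of \<open>H\<close>; the operations of the two records need to agree only on the
  carrier of \<open>K\<close>.\<close>

definition is_subspace :: "('f, 'm) ring_scheme \<Rightarrow> ('f, 'v) hspace \<Rightarrow> ('f, 'v) hspace \<Rightarrow> bool" where
  "is_subspace F K H \<longleftrightarrow> orthoclosed (horthoset F H) (carrier K) \<and> \<zero>\<^bsub>K\<^esub> = \<zero>\<^bsub>H\<^esub> \<and>
     (\<forall>u\<in>carrier K. \<forall>v\<in>carrier K. u \<oplus>\<^bsub>K\<^esub> v = u \<oplus>\<^bsub>H\<^esub> v \<and> form K u v = form H u v) \<and>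
     (\<forall>a\<in>carrier F. \<forall>u\<in>carrier K. a \<odot>\<^bsub>K\<^esub> u = a \<odot>\<^bsub>H\<^esub> u)"

locale orthomodular_space = hermitian_space +
  assumes orthomodular: "orthoclosed (horthoset F H) A
    \<Longrightarrow> carrier H = A <+>\<^bsub>H\<^esub> perp (horthoset F H) A"

locale uniform_orthomodular_space = orthomodular_space +
  assumes uniform: "\<lbrakk>orthoclosed (horthoset F H) A; has_dimension F (sub_hspace H A) 1\<rbrakk>
    \<Longrightarrow> \<exists>u\<in>A. form H u u = \<one>"

definition linear_maps ::
  "('f, 'm) ring_scheme \<Rightarrow> ('f, 'v) hspace \<Rightarrow> ('f, 'w) hspace \<Rightarrow> ('v \<Rightarrow> 'w) set" where
  "linear_maps F H K = {\<phi> \<in> carrier H \<rightarrow>\<^sub>E carrier K.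
     (\<forall>u\<in>carrier H. \<forall>v\<in>carrier H. \<phi> (u \<oplus>\<^bsub>H\<^esub> v) = \<phi> u \<oplus>\<^bsub>K\<^esub> \<phi> v) \<and>
     (\<forall>a\<in>carrier F. \<forall>u\<in>carrier H. \<phi> (a \<odot>\<^bsub>H\<^esub> u) = a \<odot>\<^bsub>K\<^esub> \<phi> u)}"

definition is_linear_adjoint ::
  "('f, 'v) hspace \<Rightarrow> ('f, 'w) hspace \<Rightarrow> ('v \<Rightarrow> 'w) \<Rightarrow> ('w \<Rightarrow> 'v) \<Rightarrow> bool" where
  "is_linear_adjoint H K \<phi> \<psi> \<longleftrightarrow> \<psi> \<in> carrier K \<rightarrow>\<^sub>E carrier H \<and>
     (\<forall>u\<in>carrier H. \<forall>v\<in>carrier K. form K (\<phi> u) v = form H u (\<psi> v))"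

definition OMS :: "'f star_ring \<Rightarrow> (('f, 'v) hspace, 'v \<Rightarrow> 'v) dagger_cat" where
  "OMS F =
     \<lparr>Obj = {H. uniform_orthomodular_space F H},
      Hom = (\<lambda>H K. {\<phi> \<in> linear_maps F H K. \<exists>\<psi>. is_linear_adjoint H K \<phi> \<psi>}),
      Cmp = (\<lambda>H K M \<psi> \<phi>. compose (carrier H) \<psi> \<phi>),
      Idt = (\<lambda>H. \<lambda>u\<in>carrier H. u),
      Dag = (\<lambda>H K \<phi>. THE \<psi>. is_linear_adjoint H K \<phi> \<psi>)\<rparr>"

text \<open>\<open>\<phi> \<oplus> \<psi> : H \<rightarrow> H'\<close> for \<open>\<phi>\<close> defined on \<open>A\<close>, \<open>\<psi>\<close> defined on \<open>B\<close>, where \<open>H\<close> is the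
  (orthogonal) direct sum of its subspaces \<open>A\<close> and \<open>B\<close>.\<close>

definition hsum_map :: "('f, 'v) hspace \<Rightarrow> 'v set \<Rightarrow> 'v set \<Rightarrow> ('f, 'w) hspace
    \<Rightarrow> ('v \<Rightarrow> 'w) \<Rightarrow> ('v \<Rightarrow> 'w) \<Rightarrow> 'v \<Rightarrow> 'w" where
  "hsum_map H A B H' \<phi> \<psi> = (\<lambda>x\<in>carrier H.
     THE y. \<exists>u\<in>A. \<exists>v\<in>B. x = u \<oplus>\<^bsub>H\<^esub> v \<and> y = \<phi> u \<oplus>\<^bsub>H'\<^esub> \<psi> v)"


section \<open>The construction of the scalars and of the functor\<close>

text \<open>The choices made: \<open>Z\<close>, \<open>HZ\<close>, \<open>r\<close>, and for each object \<open>X\<close> the biproduct \<open>S X\<close> of \<open>X\<close> and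
  \<open>Z\<close>, the space \<open>Hbar X\<close> and the map \<open>rbar X\<close>. The spaces \<open>H X\<close> and the maps \<open>rX X\<close> are
  determined by them.\<close>

locale L_construction = orthoset_category C
  for C :: "('a orthoset, 'a \<Rightarrow> 'a) dagger_cat" +
  fixes Z :: "'a orthoset"
    and F :: "'f star_ring"
    and HZ :: "('f, 'v) hspace"
    and r :: "'a set \<Rightarrow> 'v set"
    and S :: "'a orthoset \<Rightarrow> ('a orthoset, 'a \<Rightarrow> 'a) cospan"
    and Hbar :: "'a orthoset \<Rightarrow> ('f, 'v) hspace"
    and rbar :: "'a orthoset \<Rightarrow> 'a set \<Rightarrow> 'v set"
    and H :: "'a orthoset \<Rightarrow> ('f, 'v) hspace"
    and rX :: "'a orthoset \<Rightarrow> 'a set \<Rightarrow> 'v set"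
  assumes Z_Obj: "Z \<in> Obj C"
    and Z_rank: "rank Z = 3"
    and HZ_space: "uniform_orthomodular_space F HZ"
    and HZ_dimension: "has_dimension F HZ 3"
    and r_iso: "orthoiso (proj Z) (proj (horthoset F HZ)) r"
    and S_biproduct: "X \<in> Obj C \<Longrightarrow> dagger_biproduct C X Z (S X)"
    and Hbar_space: "X \<in> Obj C \<Longrightarrow> uniform_orthomodular_space F (Hbar X)"
    and HZ_subspace: "X \<in> Obj C \<Longrightarrow> is_subspace F HZ (Hbar X)"
    and rbar_iso: "X \<in> Obj C
      \<Longrightarrow> orthoiso (proj (Apex (S X))) (proj (horthoset F (Hbar X))) (rbar X)"
    and rbar_Z: "\<lbrakk>X \<in> Obj C; c \<in> carrier (proj Z)\<rbrakk>
      \<Longrightarrow> rbar X (proj_map (Apex (S X)) (Inr (S X)) c) =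
          proj_map (horthoset F (Hbar X)) (incl (carrier HZ)) (r c)"
    and H_def: "X \<in> Obj C
      \<Longrightarrow> H X = sub_hspace (Hbar X) (perp (horthoset F (Hbar X)) (carrier HZ))"
    and rX_iso: "X \<in> Obj C \<Longrightarrow> orthoiso (proj X) (proj (horthoset F (H X))) (rX X)"
    and rX_rbar: "\<lbrakk>X \<in> Obj C; c \<in> carrier (proj X)\<rbrakk>
      \<Longrightarrow> rbar X (proj_map (Apex (S X)) (Inl (S X)) c) =
          proj_map (horthoset F (Hbar X)) (incl (carrier (H X))) (rX X c)"

text \<open>The equation \<open>rbar Y \<circ> P(f \<oplus> id) = P(\<phi> \<oplus> id) \<circ> rbar X\<close> between maps on \<open>P(X \<oplus> Z)\<close>.\<close>

definition represents ::
  "('a orthoset, 'a \<Rightarrow> 'a) dagger_cat \<Rightarrow> 'a orthoset \<Rightarrow> 'f star_ring \<Rightarrow> ('f, 'v) hspace \<Rightarrow>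
   ('a orthoset \<Rightarrow> ('a orthoset, 'a \<Rightarrow> 'a) cospan) \<Rightarrow> ('a orthoset \<Rightarrow> ('f, 'v) hspace) \<Rightarrow>
   ('a orthoset \<Rightarrow> 'a set \<Rightarrow> 'v set) \<Rightarrow> ('a orthoset \<Rightarrow> ('f, 'v) hspace) \<Rightarrow>
   'a orthoset \<Rightarrow> 'a orthoset \<Rightarrow> ('a \<Rightarrow> 'a) \<Rightarrow> ('v \<Rightarrow> 'v) \<Rightarrow> bool" where
  "represents C Z F HZ S Hbar rbar H X Y f \<phi> \<longleftrightarrow>
     (\<forall>c\<in>carrier (proj (Apex (S X))).
        rbar Y (proj_map (Apex (S Y)) (sum_morphism C X Z (S X) Y Z (S Y) f (Idt C Z)) c) =
        proj_map (horthoset F (Hbar Y))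
          (hsum_map (Hbar X) (carrier (H X)) (carrier HZ) (Hbar Y) \<phi> (incl (carrier HZ)))
          (rbar X c))"

text \<open>\<open>L f\<close> is the only linear map that represents \<open>f\<close>. That a unique such map exists and that
  \<open>L\<close> is a dagger functor are part of what it means for \<open>L\<close> to be well-defined.\<close>

locale L_functor = L_construction C Z F HZ r S Hbar rbar H rX + dagger_functor C "OMS F" L
  for C :: "('a orthoset, 'a \<Rightarrow> 'a) dagger_cat"
    and Z :: "'a orthoset"
    and F :: "'f star_ring"
    and HZ :: "('f, 'v) hspace"
    and r :: "'a set \<Rightarrow> 'v set"
    and S :: "'a orthoset \<Rightarrow> ('a orthoset, 'a \<Rightarrow> 'a) cospan"
    and Hbar :: "'a orthoset \<Rightarrow> ('f, 'v) hspace"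
    and rbar :: "'a orthoset \<Rightarrow> 'a set \<Rightarrow> 'v set"
    and H :: "'a orthoset \<Rightarrow> ('f, 'v) hspace"
    and rX :: "'a orthoset \<Rightarrow> 'a set \<Rightarrow> 'v set"
    and L :: "('a orthoset, 'a \<Rightarrow> 'a, ('f, 'v) hspace, 'v \<Rightarrow> 'v) cfunctor" +
  assumes L_Obj: "X \<in> Obj C \<Longrightarrow> Fobj L X = H X"
    and L_linear: "\<lbrakk>X \<in> Obj C; Y \<in> Obj C; f \<in> Hom C X Y\<rbrakk>
      \<Longrightarrow> Fmor L X Y f \<in> linear_maps F (H X) (H Y)"
    and L_represents: "\<lbrakk>X \<in> Obj C; Y \<in> Obj C; f \<in> Hom C X Y\<rbrakk>
      \<Longrightarrow> represents C Z F HZ S Hbar rbar H X Y f (Fmor L X Y f)"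
    and L_unique: "\<lbrakk>X \<in> Obj C; Y \<in> Obj C; f \<in> Hom C X Y; \<phi> \<in> linear_maps F (H X) (H Y);
        represents C Z F HZ S Hbar rbar H X Y f \<phi>\<rbrakk>
      \<Longrightarrow> \<phi> = Fmor L X Y f"

end

theory Submission
  imports Defs
begin

text \<open>
  Suppose \<open>L f = L g\<close> for \<open>f, g : X \<rightarrow> Y\<close>. As \<open>L f\<close> represents \<open>f \<oplus> id\<close> and \<open>rbar Y\<close> is injective,
  the maps \<open>h = f \<oplus> id\<close> and \<open>k = g \<oplus> id\<close> from \<open>X \<oplus> Z\<close> to \<open>Y \<oplus> Z\<close> agree up to \<open>\<parallel>\<close>, that is,
  projectively. The second summand, on which both are the identity, removes the remaining freedom,
  just as a linear map \<open>\<phi>\<close> is determined by the projective map that \<open>\<phi> \<oplus> id\<close> induces.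

  It is enough to compare \<open>f\<close> and \<open>g\<close> on the subspace \<open>U = {x}\<^sup>\<bottom>\<^sup>\<bottom>\<close> spanned by a proper \<open>x\<close>.
  This \<open>U\<close> is unital, as is the span \<open>W\<close> of a proper element of \<open>Z\<close>, and so there is an injective
  morphism \<open>w : U \<rightarrow> W \<rightarrow> Z\<close> (lemma \<open>unital_embedding\<close>). Daggers turn the
  coproduct \<open>X \<oplus> Z\<close> into a product; let \<open>d : U \<rightarrow> X \<oplus> Z\<close> be the graph of \<open>w\<close>, with components the
  inclusion of \<open>U\<close> and \<open>w\<close>. Then \<open>s = h \<circ> d\<close> and \<open>t = k \<circ> d\<close> have second component \<open>w\<close>, and
  \<open>s x \<parallel> t x\<close>. The heart of the proof is lemma \<open>projectively_equal_morphisms_agree\<close>: maps with an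
  adjoint cannot leave bipolars, so \<open>s\<close> and \<open>t\<close> both map \<open>U\<close> into the unital subspace
  \<open>D = {s x}\<^sup>\<bottom>\<^sup>\<bottom> = {t x}\<^sup>\<bottom>\<^sup>\<bottom>\<close>. Corestricted to \<open>D\<close>, the non-zero morphism \<open>s\<close> is an
  isomorphism, so \<open>t = s \<circ> c\<close> for some \<open>c : U \<rightarrow> U\<close>. Comparing second components gives
  \<open>w = w \<circ> c\<close>, hence \<open>c = id\<close> and \<open>s = t\<close>. The first components of \<open>s\<close> and \<open>t\<close> are the restrictions
  of \<open>f\<close> and \<open>g\<close> to \<open>U\<close>, hence \<open>f x = g x\<close>.
\<close>

section \<open>Bipolars in orthosets\<close>

context orthoset
begin

lemma perp_subset: "perp X A \<subseteq> carrier X"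
  by (auto simp: perp_def)

lemma perp_antimono: "A \<subseteq> B \<Longrightarrow> perp X B \<subseteq> perp X A"
  by (auto simp: perp_def)

lemma subset_bipolar: "A \<subseteq> carrier X \<Longrightarrow> A \<subseteq> perp X (perp X A)"
  by (auto simp: perp_def intro: orth_sym)

lemma orthoclosed_bipolar: "A \<subseteq> carrier X \<Longrightarrow> orthoclosed X (perp X (perp X A))"
  unfolding orthoclosed_def
  by (meson perp_antimono perp_subset subset_antisym subset_bipolar)

lemma zero_if_orth_all: "\<lbrakk>x \<in> carrier X; \<And>y. y \<in> carrier X \<Longrightarrow> orth X x y\<rbrakk> \<Longrightarrow> x = ozero X"
  using orth_self by blast

lemma orthoclosed_zero: "orthoclosed X {ozero X}"
proof -
  have "perp X {ozero X} = carrier X"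
    by (auto simp: perp_def intro: orth_sym orth_zero)
  moreover have "perp X (carrier X) = {ozero X}"
    by (auto simp: perp_def intro: zero_if_orth_all zero_closed orth_zero)
  ultimately show ?thesis
    by (simp add: orthoclosed_def zero_closed)
qed

text \<open>An element of \<open>{x}\<^sup>\<bottom>\<^sup>\<bottom>\<close> that is orthogonal to \<open>x\<close> lies in \<open>{x}\<^sup>\<bottom>\<close> as well, so it is orthogonal
  to itself. Hence \<open>x\<close> witnesses that its span is unital.\<close>

lemma orth_generator_imp_zero:
  assumes "y \<in> perp X (perp X {x})" and "orth X y x"
  shows "y = ozero X"
  using assms by (auto simp: perp_def intro: orth_self)

lemma unital_span:
  assumes "proper X x"
  shows "unital (sub_orthoset X (perp X (perp X {x})))"
  unfolding unital_def
proof (intro exI[of _ x] conjI allI impI notI)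
  have x: "x \<in> perp X (perp X {x})"
    using assms subset_bipolar[of "{x}"] by (simp add: proper_def)
  then show "proper (sub_orthoset X (perp X (perp X {x}))) x"
    using assms by (simp add: proper_def sub_orthoset_def)
  show False if "proper (sub_orthoset X (perp X (perp X {x}))) y"
      and "orth (sub_orthoset X (perp X (perp X {x}))) y x" for y
    using that orth_generator_imp_zero by (auto simp: proper_def sub_orthoset_def)
qed

lemma pclass_eq_iff_parallel:
  assumes "x \<in> carrier X" and "y \<in> carrier X"
  shows "pclass X x = pclass X y \<longleftrightarrow> parallel X x y"
  using assms by (auto simp: pclass_def parallel_def)

end

lemma proper_exists_if_rank_nonzero:
  assumes "rank X \<noteq> 0"
  shows "\<exists>x. proper X x"
proof (rule ccontr)
  assume "\<nexists>x. proper X x"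
  then have "{A. orthogonal_set X A} = {{}}"
    by (auto simp: orthogonal_set_def)
  then show False
    using assms by (simp add: rank_def zero_enat_def)
qed


section \<open>Morphisms as adjointable maps\<close>

context orthoset_category
begin

lemma Hom_closed:
  "\<lbrakk>X \<in> Obj C; Y \<in> Obj C; f \<in> Hom C X Y; x \<in> carrier X\<rbrakk> \<Longrightarrow> f x \<in> carrier Y"
  using Hom_map by blast

lemma Hom_extensional: "\<lbrakk>X \<in> Obj C; Y \<in> Obj C; f \<in> Hom C X Y\<rbrakk> \<Longrightarrow> f \<in> extensional (carrier X)"
  using Hom_map by (fastforce simp: PiE_def)

lemma Hom_eqI:
  assumes "X \<in> Obj C" "Y \<in> Obj C" "f \<in> Hom C X Y" "g \<in> Hom C X Y"
    and "\<And>x. x \<in> carrier X \<Longrightarrow> f x = g x"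
  shows "f = g"
  using assms by (blast intro: extensionalityI[of _ "carrier X"] Hom_extensional)

lemma Cmp_apply:
  assumes "X \<in> Obj C" "Y \<in> Obj C" "Z \<in> Obj C" "f \<in> Hom C X Y" "g \<in> Hom C Y Z" "x \<in> carrier X"
  shows "Cmp C X Y Z g f x = g (f x)"
  using assms by (simp add: Cmp_eq compose_def)

lemma orth_Dag_iff:
  assumes "X \<in> Obj C" "Y \<in> Obj C" "f \<in> Hom C X Y" "x \<in> carrier X" "y \<in> carrier Y"
  shows "orth Y (f x) y \<longleftrightarrow> orth X x (Dag C X Y f y)"
  using Dag_adjoint[OF assms(1-3)] assms(4,5) by (simp add: is_adjoint_def)

lemma Dag_closed:
  "\<lbrakk>X \<in> Obj C; Y \<in> Obj C; f \<in> Hom C X Y; y \<in> carrier Y\<rbrakk> \<Longrightarrow> Dag C X Y f y \<in> carrier X"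
  using Dag_in Hom_closed by blast

lemma Hom_zero:
  assumes "X \<in> Obj C" "Y \<in> Obj C" "f \<in> Hom C X Y"
  shows "f (ozero X) = ozero Y"
proof -
  interpret X: orthoset X by (rule Obj_orthoset[OF assms(1)])
  interpret Y: orthoset Y by (rule Obj_orthoset[OF assms(2)])
  have "orth Y (f (ozero X)) y" if "y \<in> carrier Y" for y
    using orth_Dag_iff[OF assms X.zero_closed that] X.orth_zero Dag_closed[OF assms that] by blast
  then show ?thesis
    using Y.zero_if_orth_all Hom_closed[OF assms X.zero_closed] by blast
qed

lemma Dag_apply_left_inverse:
  assumes "dagger_mono C X Y f" "X \<in> Obj C" "Y \<in> Obj C" "x \<in> carrier X"
  shows "Dag C X Y f (f x) = x"
proof -
  have f: "f \<in> Hom C X Y" and eq: "Cmp C X Y X (Dag C X Y f) f = Idt C X"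
    using assms(1) by (auto simp: dagger_mono_def)
  have "Dag C X Y f (f x) = Idt C X x"
    using Cmp_apply[OF assms(2,3,2) f Dag_in[OF assms(2,3) f] assms(4)] eq by simp
  then show ?thesis
    using assms by (simp add: Idt_eq)
qed

lemma isomorphism_inj_on:
  assumes "isomorphism C X Y f" "X \<in> Obj C" "Y \<in> Obj C"
  shows "inj_on f (carrier X)"
proof -
  obtain g where f: "f \<in> Hom C X Y" and g: "g \<in> Hom C Y X" "Cmp C X Y X g f = Idt C X"
    using assms(1) by (auto simp: isomorphism_def)
  have "g (f x) = x" if "x \<in> carrier X" for x
    using Cmp_apply[OF assms(2,3,2) f g(1) that] g(2) that assms(2) by (simp add: Idt_eq)
  then show ?thesis
    by (rule inj_on_inverseI)
qed

text \<open>Orthogonality of \<open>f y\<close> to \<open>z\<close> is orthogonality of \<open>y\<close> to the adjoint image of \<open>z\<close>, and so is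
  inherited from \<open>A\<close> by the elements of \<open>A\<^sup>\<bottom>\<^sup>\<bottom>\<close>.\<close>

lemma Hom_bipolar:
  assumes "X \<in> Obj C" "Y \<in> Obj C" "f \<in> Hom C X Y" "A \<subseteq> carrier X"
    and "y \<in> perp X (perp X A)"
  shows "f y \<in> perp Y (perp Y (f ` A))"
proof -
  interpret X: orthoset X by (rule Obj_orthoset[OF assms(1)])
  interpret Y: orthoset Y by (rule Obj_orthoset[OF assms(2)])
  have y: "y \<in> carrier X"
    using assms(5) X.perp_subset by blast
  have "orth Y (f y) z" if z: "z \<in> perp Y (f ` A)" for z
  proof -
    have zY: "z \<in> carrier Y"
      using z by (simp add: perp_def)
    have "orth X (Dag C X Y f z) a" if "a \<in> A" for a
    proof -
      have "orth Y (f a) z"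
        using z that by (auto simp: perp_def intro: Y.orth_sym)
      then show ?thesis
        using orth_Dag_iff[OF assms(1-3) _ zY, of a] that assms(4) X.orth_sym by blast
    qed
    then have "Dag C X Y f z \<in> perp X A"
      using Dag_closed[OF assms(1-3) zY] by (simp add: perp_def)
    then have "orth X y (Dag C X Y f z)"
      using assms(5) by (simp add: perp_def)
    then show ?thesis
      using orth_Dag_iff[OF assms(1-3) y zY] by simp
  qed
  then show ?thesis
    using Hom_closed[OF assms(1-3) y] by (simp add: perp_def)
qed

lemma Hom_parallel:
  assumes "X \<in> Obj C" "Y \<in> Obj C" "f \<in> Hom C X Y" "x \<in> carrier X" "y \<in> carrier X"
    and "parallel X x y"
  shows "parallel Y (f x) (f y)"
proof -
  interpret X: orthoset X by (rule Obj_orthoset[OF assms(1)])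
  interpret Y: orthoset Y by (rule Obj_orthoset[OF assms(2)])
  have xy: "orth X x z \<longleftrightarrow> orth X y z" if "z \<in> carrier X" for z
    using assms(6) that X.orth_sym by (auto simp: parallel_def perp_def)
  have "orth Y (f x) z \<longleftrightarrow> orth Y (f y) z" if "z \<in> carrier Y" for z
    using orth_Dag_iff[OF assms(1-3) _ that] assms(4,5) xy[OF Dag_closed[OF assms(1-3) that]]
    by blast
  then show ?thesis
    using Y.orth_sym by (auto simp: parallel_def perp_def)
qed

lemma proj_map_pclass:
  assumes "X \<in> Obj C" "Y \<in> Obj C" "f \<in> Hom C X Y" "x \<in> carrier X"
  shows "proj_map Y f (pclass X x) = pclass Y (f x)"
proof -
  interpret Y: orthoset Y by (rule Obj_orthoset[OF assms(2)])
  have "pclass Y (f y) = pclass Y (f x)" if "y \<in> pclass X x" for y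
  proof -
    have y: "y \<in> carrier X" "parallel X y x"
      using that by (auto simp: pclass_def parallel_def)
    then have "parallel Y (f y) (f x)"
      using Hom_parallel[OF assms(1-3) _ assms(4)] by blast
    then show ?thesis
      using Y.pclass_eq_iff_parallel Hom_closed[OF assms(1-3)] y(1) assms(4) by blast
  qed
  moreover have "x \<in> pclass X x"
    using assms by (simp add: pclass_def parallel_def)
  ultimately have "(\<lambda>y. pclass Y (f y)) ` pclass X x = {pclass Y (f x)}"
    by blast
  then show ?thesis
    by (simp add: proj_map_def)
qed

text \<open>The dagger of the copairing of the daggers is a pairing.\<close>

lemma pairing:
  assumes S: "dagger_biproduct C A B S" and U: "U \<in> Obj C"
    and a: "a \<in> Hom C U A" and b: "b \<in> Hom C U B"
  obtains d where "d \<in> Hom C U (Apex S)"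
    and "Cmp C U (Apex S) A (Dag C A (Apex S) (Inl S)) d = a"
    and "Cmp C U (Apex S) B (Dag C B (Apex S) (Inr S)) d = b"
proof -
  have cop: "coproduct C A B S"
    using S by (simp add: dagger_biproduct_def)
  then have obj: "A \<in> Obj C" "B \<in> Obj C" "Apex S \<in> Obj C"
    and inj: "Inl S \<in> Hom C A (Apex S)" "Inr S \<in> Hom C B (Apex S)"
    by (auto simp: coproduct_def)
  have "Dag C U A a \<in> Hom C A U" "Dag C U B b \<in> Hom C B U"
    using obj U a b Dag_in by blast+
  then obtain e where e: "e \<in> Hom C (Apex S) U"
      "Cmp C A (Apex S) U e (Inl S) = Dag C U A a"
      "Cmp C B (Apex S) U e (Inr S) = Dag C U B b"
    using cop U unfolding coproduct_def by metis
  show ?thesis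
  proof (rule that[of "Dag C (Apex S) U e"])
    show "Dag C (Apex S) U e \<in> Hom C U (Apex S)"
      using Dag_in obj U e(1) by blast
    show "Cmp C U (Apex S) A (Dag C A (Apex S) (Inl S)) (Dag C (Apex S) U e) = a"
      using Dag_Cmp[OF obj(1,3) U inj(1) e(1)] e(2) Dag_Dag[OF U obj(1) a] by simp
    show "Cmp C U (Apex S) B (Dag C B (Apex S) (Inr S)) (Dag C (Apex S) U e) = b"
      using Dag_Cmp[OF obj(2,3) U inj(2) e(1)] e(3) Dag_Dag[OF U obj(2) b] by simp
  qed
qed

lemma sum_morphism_props:
  assumes S: "coproduct C A B S" and S': "coproduct C A' B' S'"
    and f: "f \<in> Hom C A A'" and g: "g \<in> Hom C B B'"
  defines "h \<equiv> sum_morphism C A B S A' B' S' f g"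
  shows "h \<in> Hom C (Apex S) (Apex S')"
    and "Cmp C A (Apex S) (Apex S') h (Inl S) = Cmp C A A' (Apex S') (Inl S') f"
    and "Cmp C B (Apex S) (Apex S') h (Inr S) = Cmp C B B' (Apex S') (Inr S') g"
proof -
  have "Apex S' \<in> Obj C" "Cmp C A A' (Apex S') (Inl S') f \<in> Hom C A (Apex S')"
      "Cmp C B B' (Apex S') (Inr S') g \<in> Hom C B (Apex S')"
    using S S' f g by (auto simp: coproduct_def intro: Cmp_in)
  then have "\<exists>!h. h \<in> Hom C (Apex S) (Apex S') \<and>
      Cmp C A (Apex S) (Apex S') h (Inl S) = Cmp C A A' (Apex S') (Inl S') f \<and>
      Cmp C B (Apex S) (Apex S') h (Inr S) = Cmp C B B' (Apex S') (Inr S') g"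
    using S by (auto simp: coproduct_def)
  from theI'[OF this, folded sum_morphism_def, folded h_def]
  show "h \<in> Hom C (Apex S) (Apex S')"
    and "Cmp C A (Apex S) (Apex S') h (Inl S) = Cmp C A A' (Apex S') (Inl S') f"
    and "Cmp C B (Apex S) (Apex S') h (Inr S) = Cmp C B B' (Apex S') (Inr S') g"
    by blast+
qed

lemma coproduct_eqI:
  assumes "coproduct C A B S" "X \<in> Obj C" "h \<in> Hom C (Apex S) X" "k \<in> Hom C (Apex S) X"
    and "Cmp C A (Apex S) X h (Inl S) = Cmp C A (Apex S) X k (Inl S)"
    and "Cmp C B (Apex S) X h (Inr S) = Cmp C B (Apex S) X k (Inr S)"
  shows "h = k"
proof -
  have "Cmp C A (Apex S) X k (Inl S) \<in> Hom C A X" "Cmp C B (Apex S) X k (Inr S) \<in> Hom C B X"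
    using assms by (auto simp: coproduct_def intro: Cmp_in)
  then show ?thesis
    using assms unfolding coproduct_def by blast
qed

end


section \<open>Categories closed under subspaces\<close>

locale subspace_category = orthoset_category C
  for C :: "('a orthoset, 'a \<Rightarrow> 'a) dagger_cat" +
  assumes subspace: "\<lbrakk>X \<in> Obj C; orthoclosed X A\<rbrakk> \<Longrightarrow>
        sub_orthoset X A \<in> Obj C \<and> incl A \<in> Hom C (sub_orthoset X A) X \<and>
        dagger_mono C (sub_orthoset X A) X (incl A)"
begin

lemma incl_Dag_apply:
  assumes "X \<in> Obj C" "orthoclosed X A" "x \<in> A"
  shows "Dag C (sub_orthoset X A) X (incl A) x = x"
  using Dag_apply_left_inverse[of "sub_orthoset X A" X "incl A" x] subspace[OF assms(1,2)] assms
  by (simp add: incl_def sub_orthoset_def)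

text \<open>A zero object has only one endomorphism, and its identity therefore factors through its
  subspace \<open>{0}\<close>.\<close>

lemma zero_object_carrier:
  assumes "zero_object C N"
  shows "carrier N = {ozero N}"
proof -
  have N: "N \<in> Obj C"
    using assms by (simp add: zero_object_def)
  interpret N: orthoset N by (rule Obj_orthoset[OF N])
  let ?O = "sub_orthoset N {ozero N}" and ?i = "incl {ozero N}"
  note sub = subspace[OF N N.orthoclosed_zero]
  have p: "Dag C ?O N ?i \<in> Hom C N ?O"
    using sub N Dag_in by blast
  then have "Cmp C N ?O N ?i (Dag C ?O N ?i) \<in> Hom C N N"
    using sub N Cmp_in by blast
  then have eq: "Cmp C N ?O N ?i (Dag C ?O N ?i) = Idt C N"
    using assms Idt_in[OF N] N by (metis zero_object_def)
  have "x = ozero N" if x: "x \<in> carrier N" for x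
  proof -
    have "x = ?i (Dag C ?O N ?i x)"
      using Cmp_apply[of N ?O N "Dag C ?O N ?i" ?i x] eq sub N p x by (simp add: Idt_eq)
    moreover have "Dag C ?O N ?i x \<in> {ozero N}"
      using Hom_closed[of N ?O "Dag C ?O N ?i" x] sub N p x by (simp add: sub_orthoset_def)
    ultimately show ?thesis
      by (simp add: incl_def)
  qed
  then show ?thesis
    using N.zero_closed by blast
qed

lemma zero_morphism_apply:
  assumes "zero_morphism C X Y f" "X \<in> Obj C" "Y \<in> Obj C" "x \<in> carrier X"
  shows "f x = ozero Y"
proof -
  obtain N g h where N: "zero_object C N" and g: "g \<in> Hom C X N" and h: "h \<in> Hom C N Y"
    and f: "f = Cmp C X N Y h g"
    using assms(1) by (auto simp: zero_morphism_def)
  have NO: "N \<in> Obj C"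
    using N by (simp add: zero_object_def)
  have "g x = ozero N"
    using Hom_closed[OF assms(2) NO g assms(4)] zero_object_carrier[OF N] by simp
  then show ?thesis
    using Cmp_apply[OF assms(2) NO assms(3) g h assms(4)] f Hom_zero[OF NO assms(3) h] by simp
qed

lemma biproduct_components:
  assumes S: "dagger_biproduct C A B S"
  shows "a \<in> carrier A \<Longrightarrow> Dag C A (Apex S) (Inl S) (Inl S a) = a"
    and "b \<in> carrier B \<Longrightarrow> Dag C B (Apex S) (Inr S) (Inr S b) = b"
    and "a \<in> carrier A \<Longrightarrow> Dag C B (Apex S) (Inr S) (Inl S a) = ozero B"
    and "b \<in> carrier B \<Longrightarrow> Dag C A (Apex S) (Inl S) (Inr S b) = ozero A"
proof -
  have obj: "A \<in> Obj C" "B \<in> Obj C" "Apex S \<in> Obj C"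
    and inj: "Inl S \<in> Hom C A (Apex S)" "Inr S \<in> Hom C B (Apex S)"
    and mono: "dagger_mono C A (Apex S) (Inl S)" "dagger_mono C B (Apex S) (Inr S)"
    and zero: "zero_morphism C A B (Cmp C A (Apex S) B (Dag C B (Apex S) (Inr S)) (Inl S))"
    using S by (auto simp: dagger_biproduct_def coproduct_def)
  interpret A: orthoset A by (rule Obj_orthoset[OF obj(1)])
  interpret B: orthoset B by (rule Obj_orthoset[OF obj(2)])
  interpret P: orthoset "Apex S" by (rule Obj_orthoset[OF obj(3)])
  show "Dag C A (Apex S) (Inl S) (Inl S a) = a" if "a \<in> carrier A"
    using Dag_apply_left_inverse mono(1) obj that by blast
  show "Dag C B (Apex S) (Inr S) (Inr S b) = b" if "b \<in> carrier B"
    using Dag_apply_left_inverse mono(2) obj that by blast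
  show RL: "Dag C B (Apex S) (Inr S) (Inl S a) = ozero B" if "a \<in> carrier A" for a
    using zero_morphism_apply[OF zero obj(1,2) that]
      Cmp_apply[OF obj(1,3,2) inj(1) Dag_in[OF obj(2,3) inj(2)] that] by simp
  show "Dag C A (Apex S) (Inl S) (Inr S b) = ozero A" if b: "b \<in> carrier B"
  proof (rule A.zero_if_orth_all)
    have bP: "Inr S b \<in> carrier (Apex S)"
      using Hom_closed[OF obj(2,3) inj(2) b] .
    show "Dag C A (Apex S) (Inl S) (Inr S b) \<in> carrier A"
      using Dag_closed[OF obj(1,3) inj(1) bP] .
    fix a assume a: "a \<in> carrier A"
    have aP: "Inl S a \<in> carrier (Apex S)"
      using Hom_closed[OF obj(1,3) inj(1) a] .
    have "orth B b (Dag C B (Apex S) (Inr S) (Inl S a))"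
      using RL[OF a] B.orth_zero[OF b] B.orth_sym by simp
    then have "orth (Apex S) (Inl S a) (Inr S b)"
      using orth_Dag_iff[OF obj(2,3) inj(2) b aP] P.orth_sym by blast
    then show "orth A (Dag C A (Apex S) (Inl S) (Inr S b)) a"
      using orth_Dag_iff[OF obj(1,3) inj(1) a bP] A.orth_sym by blast
  qed
qed

text \<open>Both equations are equalities of morphisms out of a coproduct, and so may be tested on
  the two injections.\<close>

lemma sum_morphism_components:
  assumes S: "dagger_biproduct C A B S" and S': "dagger_biproduct C A' B' S'"
    and f: "f \<in> Hom C A A'" and g: "g \<in> Hom C B B'" and p: "p \<in> carrier (Apex S)"
  defines "h \<equiv> sum_morphism C A B S A' B' S' f g"
  shows "Dag C A' (Apex S') (Inl S') (h p) = f (Dag C A (Apex S) (Inl S) p)"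
    and "Dag C B' (Apex S') (Inr S') (h p) = g (Dag C B (Apex S) (Inr S) p)"
proof -
  have cop: "coproduct C A B S" "coproduct C A' B' S'"
    using S S' by (auto simp: dagger_biproduct_def)
  have obj: "A \<in> Obj C" "B \<in> Obj C" "Apex S \<in> Obj C"
    and inj: "Inl S \<in> Hom C A (Apex S)" "Inr S \<in> Hom C B (Apex S)"
    using cop(1) by (auto simp: coproduct_def)
  have obj': "A' \<in> Obj C" "B' \<in> Obj C" "Apex S' \<in> Obj C"
    and inj': "Inl S' \<in> Hom C A' (Apex S')" "Inr S' \<in> Hom C B' (Apex S')"
    using cop(2) by (auto simp: coproduct_def)
  note h = sum_morphism_props[OF cop f g, folded h_def]
  note pr = Dag_in[OF obj(1,3) inj(1)] Dag_in[OF obj(2,3) inj(2)]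
  note pr' = Dag_in[OF obj'(1,3) inj'(1)] Dag_in[OF obj'(2,3) inj'(2)]
  have hl: "h (Inl S a) = Inl S' (f a)" if "a \<in> carrier A" for a
    using h(2) Cmp_apply[OF obj(1,3) obj'(3) inj(1) h(1) that]
      Cmp_apply[OF obj(1) obj'(1,3) f inj'(1) that] by simp
  have hr: "h (Inr S b) = Inr S' (g b)" if "b \<in> carrier B" for b
    using h(3) Cmp_apply[OF obj(2,3) obj'(3) inj(2) h(1) that]
      Cmp_apply[OF obj(2) obj'(2,3) g inj'(2) that] by simp
  note closed = Hom_closed[OF obj(1) obj'(1) f] Hom_closed[OF obj(2) obj'(2) g]
    Hom_closed[OF obj(1,3) inj(1)] Hom_closed[OF obj(2,3) inj(2)]
  note apply_simps = Cmp_apply obj obj' inj inj' pr pr' f g h(1) Cmp_in hl hr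
    biproduct_components[OF S] biproduct_components[OF S'] closed
    Hom_zero[OF obj(1) obj'(1) f] Hom_zero[OF obj(2) obj'(2) g]
  have "Cmp C (Apex S) (Apex S') A' (Dag C A' (Apex S') (Inl S')) h =
      Cmp C (Apex S) A A' f (Dag C A (Apex S) (Inl S))"
    by (rule coproduct_eqI[OF cop(1) obj'(1)];
        (rule Hom_eqI[OF obj(1) obj'(1)] Hom_eqI[OF obj(2) obj'(1)])?; simp add: apply_simps)
  then show "Dag C A' (Apex S') (Inl S') (h p) = f (Dag C A (Apex S) (Inl S) p)"
    using Cmp_apply[OF obj(3) obj'(3,1) h(1) pr'(1) p] Cmp_apply[OF obj(3,1) obj'(1) pr(1) f p]
    by simp
  have "Cmp C (Apex S) (Apex S') B' (Dag C B' (Apex S') (Inr S')) h =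
      Cmp C (Apex S) B B' g (Dag C B (Apex S) (Inr S))"
    by (rule coproduct_eqI[OF cop(1) obj'(2)];
        (rule Hom_eqI[OF obj(1) obj'(2)] Hom_eqI[OF obj(2) obj'(2)])?; simp add: apply_simps)
  then show "Dag C B' (Apex S') (Inr S') (h p) = g (Dag C B (Apex S) (Inr S) p)"
    using Cmp_apply[OF obj(3) obj'(3,2) h(1) pr'(2) p] Cmp_apply[OF obj(3,2) obj'(2) pr(2) g p]
    by simp
qed

end


section \<open>Rigidity of morphisms out of unital objects\<close>

locale rigid_category = subspace_category +
  assumes nonzero_unital_iso: "\<lbrakk>X \<in> Obj C; Y \<in> Obj C; unital X; unital Y; f \<in> Hom C X Y;
        \<not> zero_morphism C X Y f\<rbrakk> \<Longrightarrow> isomorphism C X Y f"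
    and dagger_mono_total: "\<lbrakk>X \<in> Obj C; Y \<in> Obj C\<rbrakk> \<Longrightarrow>
        (\<exists>f. dagger_mono C X Y f) \<or> (\<exists>f. dagger_mono C Y X f)"
begin

text \<open>A dagger monomorphism between unital objects is non-zero, hence invertible, so its direction
  does not matter.\<close>

lemma unital_embedding:
  assumes U: "U \<in> Obj C" "unital U" and W: "W \<in> Obj C" "unital W"
  obtains w where "w \<in> Hom C U W" "inj_on w (carrier U)"
proof -
  have iso: "isomorphism C A B v"
    if v: "dagger_mono C A B v" and A: "A \<in> Obj C" "unital A" and B: "B \<in> Obj C" "unital B"
    for A B v
  proof -
    obtain z where z: "z \<in> carrier A" "z \<noteq> ozero A"
      using A(2) by (auto simp: unital_def proper_def)
    have vH: "v \<in> Hom C A B"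
      using v by (simp add: dagger_mono_def)
    have "\<not> zero_morphism C A B v"
    proof
      assume "zero_morphism C A B v"
      then have "v z = ozero B"
        using zero_morphism_apply A(1) B(1) z(1) by blast
      then have "Dag C A B v (v z) = ozero A"
        using Hom_zero[OF B(1) A(1) Dag_in[OF A(1) B(1) vH]] by simp
      then show False
        using Dag_apply_left_inverse[OF v A(1) B(1) z(1)] z(2) by simp
    qed
    then show ?thesis
      using nonzero_unital_iso A B vH by blast
  qed
  consider v where "dagger_mono C U W v" | v where "dagger_mono C W U v"
    using dagger_mono_total[OF U(1) W(1)] by blast
  then have "\<exists>w. isomorphism C U W w"
  proof cases
    case (1 v)
    then show ?thesis using iso U W by blast
  next
    case (2 v)
    then have "isomorphism C W U v" using iso U W by blast
    then show ?thesis by (auto simp: isomorphism_def)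
  qed
  then show ?thesis
    using that isomorphism_inj_on[OF _ U(1) W(1)] by (meson isomorphism_def)
qed

text \<open>If \<open>s\<close> and \<open>t\<close> are projectively equal, they factor through the same unital subspace and so
  differ by an endomorphism \<open>c\<close> of \<open>U\<close>. An injective common component \<open>q \<circ> s = q \<circ> t\<close> excludes
  every \<open>c\<close> but the identity. That \<open>x\<close> generates \<open>U\<close> is what reduces projective equality to
  the single point \<open>x\<close>.\<close>

lemma projectively_equal_morphisms_agree:
  assumes U: "U \<in> Obj C" and x: "proper U x" "\<And>y. proper U y \<Longrightarrow> \<not> orth U y x"
    and Q: "Q \<in> Obj C" and R: "R \<in> Obj C"
    and s: "s \<in> Hom C U Q" and t: "t \<in> Hom C U Q" and q: "q \<in> Hom C Q R"
    and par: "parallel Q (s x) (t x)"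
    and same: "\<And>y. y \<in> carrier U \<Longrightarrow> q (t y) = q (s y)"
    and inj: "inj_on (\<lambda>y. q (s y)) (carrier U)"
  shows "s = t"
proof -
  interpret U: orthoset U by (rule Obj_orthoset[OF U])
  interpret Q: orthoset Q by (rule Obj_orthoset[OF Q])
  have xU: "x \<in> carrier U" "x \<noteq> ozero U"
    using x(1) by (auto simp: proper_def)
  have "perp U {x} \<subseteq> {ozero U}"
    using x(2) by (auto simp: perp_def proper_def)
  then have "perp U {ozero U} \<subseteq> perp U (perp U {x})"
    by (rule U.perp_antimono)
  then have span: "y \<in> perp U (perp U {x})" if "y \<in> carrier U" for y
    using that U.orth_zero U.orth_sym by (auto simp: perp_def)
  define D where "D = perp Q (perp Q {s x})"
  have sxQ: "s x \<in> carrier Q"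
    using Hom_closed[OF U Q s xU(1)] .
  have D: "orthoclosed Q D"
    unfolding D_def using Q.orthoclosed_bipolar sxQ by simp
  have D_t: "D = perp Q (perp Q {t x})"
    using par by (simp add: D_def parallel_def)
  have sD: "s y \<in> D" if "y \<in> carrier U" for y
    using Hom_bipolar[OF U Q s, of "{x}"] xU(1) span[OF that] by (simp add: D_def)
  have tD: "t y \<in> D" if "y \<in> carrier U" for y
    using Hom_bipolar[OF U Q t, of "{x}"] xU(1) span[OF that] by (simp add: D_t)
  have s0: "s (ozero U) = ozero Q"
    using Hom_zero[OF U Q s] .
  have sx: "s x \<noteq> ozero Q"
    using inj_onD[OF inj, of x "ozero U"] xU U.zero_closed s0 by auto
  let ?D = "sub_orthoset Q D"
  let ?p = "Dag C ?D Q (incl D)"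
  have D_obj: "?D \<in> Obj C" and p: "?p \<in> Hom C Q ?D"
    using subspace[OF Q D] Dag_in[OF _ Q] by blast+
  have pD: "?p y = y" if "y \<in> D" for y
    using incl_Dag_apply[OF Q D that] .
  let ?a = "Cmp C U Q ?D ?p s" and ?b = "Cmp C U Q ?D ?p t"
  have a: "?a \<in> Hom C U ?D" and b: "?b \<in> Hom C U ?D"
    using Cmp_in U Q D_obj s t p by blast+
  have a_apply: "?a y = s y" and b_apply: "?b y = t y" if "y \<in> carrier U" for y
    using Cmp_apply[OF U Q D_obj s p that] Cmp_apply[OF U Q D_obj t p that]
      pD sD[OF that] tD[OF that] by simp_all
  have "\<not> zero_morphism C U ?D ?a"
    using zero_morphism_apply[OF _ U D_obj xU(1), of ?a] a_apply[OF xU(1)] sx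
    by (auto simp: sub_orthoset_def)
  moreover have "unital U"
    using x by (auto simp: unital_def)
  moreover have "unital ?D"
    unfolding D_def using Q.unital_span sx sxQ by (simp add: proper_def)
  ultimately have "isomorphism C U ?D ?a"
    using nonzero_unital_iso[OF U D_obj _ _ a] by blast
  then obtain a' where a': "a' \<in> Hom C ?D U" "Cmp C ?D U ?D ?a a' = Idt C ?D"
    by (auto simp: isomorphism_def)
  show ?thesis
  proof (rule Hom_eqI[OF U Q s t])
    fix y assume y: "y \<in> carrier U"
    \<comment> \<open>\<open>c = a' (t y)\<close> is the value at \<open>y\<close> of the endomorphism by which \<open>s\<close> and \<open>t\<close> differ.\<close>
    let ?c = "a' (t y)"
    have ty: "t y \<in> carrier ?D"
      using tD[OF y] by (simp add: sub_orthoset_def)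
    have c: "?c \<in> carrier U"
      using Hom_closed[OF D_obj U a'(1) ty] .
    have sc: "s ?c = t y"
      using Cmp_apply[OF D_obj U D_obj a'(1) a ty] a'(2) a_apply[OF c] ty D_obj
      by (simp add: Idt_eq)
    then have "q (s ?c) = q (s y)"
      using same[OF y] by simp
    then have "?c = y"
      using inj_onD[OF inj] c y by blast
    then show "s y = t y"
      using sc by simp
  qed
qed

end


section \<open>Faithfulness\<close>

theorem lemma9p6:
  fixes C :: "('a orthoset, 'a \<Rightarrow> 'a) dagger_cat"
    and Z :: "'a orthoset"
    and F :: "'f star_ring"
    and HZ :: "('f, 'v) hspace"
    and r :: "'a set \<Rightarrow> 'v set"
    and S :: "'a orthoset \<Rightarrow> ('a orthoset, 'a \<Rightarrow> 'a) cospan"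
    and Hbar :: "'a orthoset \<Rightarrow> ('f, 'v) hspace"
    and rbar :: "'a orthoset \<Rightarrow> 'a set \<Rightarrow> 'v set"
    and H :: "'a orthoset \<Rightarrow> ('f, 'v) hspace"
    and rX :: "'a orthoset \<Rightarrow> 'a set \<Rightarrow> 'v set"
    and L :: "('a orthoset, 'a \<Rightarrow> 'a, ('f, 'v) hspace, 'v \<Rightarrow> 'v) cfunctor"
  assumes C: "orthoset_category C"
    and nonzero_rank: "\<exists>X\<in>Obj C. rank X \<noteq> 0"
    and H1: "has_dagger_biproducts C"
    and H2: "\<And>X A. \<lbrakk>X \<in> Obj C; orthoclosed X A\<rbrakk> \<Longrightarrow>
        sub_orthoset X A \<in> Obj C \<and> sub_orthoset X (perp X A) \<in> Obj C \<and>
        incl A \<in> Hom C (sub_orthoset X A) X \<and>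
        incl (perp X A) \<in> Hom C (sub_orthoset X (perp X A)) X \<and>
        dagger_biproduct C (sub_orthoset X A) (sub_orthoset X (perp X A))
          \<lparr>Apex = X, Inl = incl A, Inr = incl (perp X A)\<rparr>"
    and H3': "\<And>X Y f. \<lbrakk>X \<in> Obj C; Y \<in> Obj C; unital X; unital Y; f \<in> Hom C X Y;
        \<not> zero_morphism C X Y f\<rbrakk> \<Longrightarrow> isomorphism C X Y f"
    and H4: "\<And>X Y. \<lbrakk>X \<in> Obj C; Y \<in> Obj C\<rbrakk> \<Longrightarrow>
        (\<exists>f. dagger_mono C X Y f) \<or> (\<exists>f. dagger_mono C Y X f)"
    and L: "L_functor C Z F HZ r S Hbar rbar H rX L"
  shows "faithful C L"
proof -
  interpret orthoset_category C by (rule C)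
  interpret rigid_category C
    by unfold_locales (use H2 H3' H4 in \<open>auto simp: dagger_biproduct_def\<close>)
  interpret L: L_functor C Z F HZ r S Hbar rbar H rX L by (rule L)
  have Z: "Z \<in> Obj C"
    by (rule L.Z_Obj)
  interpret Z: orthoset Z by (rule Obj_orthoset[OF Z])
  obtain z where z: "proper Z z"
    using proper_exists_if_rank_nonzero[of Z] L.Z_rank by auto
  define W where "W = perp Z (perp Z {z})"
  have W: "orthoclosed Z W"
    unfolding W_def using Z.orthoclosed_bipolar z by (simp add: proper_def)
  note W_sub = subspace[OF Z W]
  have W_unital: "unital (sub_orthoset Z W)"
    unfolding W_def using Z.unital_span[OF z] .

  have agree: "f x = g x"
    if X: "X \<in> Obj C" and Y: "Y \<in> Obj C" and f: "f \<in> Hom C X Y" and g: "g \<in> Hom C X Y"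
      and eq: "Fmor L X Y f = Fmor L X Y g" and x: "proper X x" for X Y f g x
  proof -
    interpret X: orthoset X by (rule Obj_orthoset[OF X])
    have xX: "x \<in> carrier X"
      using x by (simp add: proper_def)
    let ?P = "Apex (S X)" and ?Q = "Apex (S Y)"
    note SX = L.S_biproduct[OF X] and SY = L.S_biproduct[OF Y]
    have P: "?P \<in> Obj C" and Q: "?Q \<in> Obj C"
      and cop: "coproduct C X Z (S X)" "coproduct C Y Z (S Y)"
      and Inl: "Inl (S X) \<in> Hom C X ?P" "Inl (S Y) \<in> Hom C Y ?Q"
      and Inr: "Inr (S X) \<in> Hom C Z ?P" "Inr (S Y) \<in> Hom C Z ?Q"
      using SX SY by (auto simp: dagger_biproduct_def coproduct_def)
    interpret Q: orthoset ?Q by (rule Obj_orthoset[OF Q])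
    define h where "h = sum_morphism C X Z (S X) Y Z (S Y) f (Idt C Z)"
    define k where "k = sum_morphism C X Z (S X) Y Z (S Y) g (Idt C Z)"
    have h: "h \<in> Hom C ?P ?Q" and k: "k \<in> Hom C ?P ?Q"
      unfolding h_def k_def using sum_morphism_props(1)[OF cop] f g Idt_in[OF Z] by blast+

    have projective: "parallel ?Q (h p) (k p)" if p: "p \<in> carrier ?P" for p
    proof -
      have hp: "h p \<in> carrier ?Q" and kp: "k p \<in> carrier ?Q"
        using Hom_closed[OF P Q] h k p by blast+
      have c: "pclass ?P p \<in> carrier (proj ?P)"
        using p by (simp add: proj_def)
      have "rbar Y (proj_map ?Q h (pclass ?P p)) = rbar Y (proj_map ?Q k (pclass ?P p))"
        using L.L_represents[OF X Y f] L.L_represents[OF X Y g] eq c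
        by (simp add: represents_def h_def k_def)
      then have "rbar Y (pclass ?Q (h p)) = rbar Y (pclass ?Q (k p))"
        using proj_map_pclass[OF P Q _ p] h k by simp
      moreover have "inj_on (rbar Y) (carrier (proj ?Q))"
        using L.rbar_iso[OF Y] by (simp add: orthoiso_def bij_betw_def)
      ultimately have "pclass ?Q (h p) = pclass ?Q (k p)"
        using hp kp by (auto simp: proj_def inj_on_def)
      then show ?thesis
        using Q.pclass_eq_iff_parallel hp kp by blast
    qed

    define A where "A = perp X (perp X {x})"
    define U where "U = sub_orthoset X A"
    have A: "orthoclosed X A"
      unfolding A_def using X.orthoclosed_bipolar xX by simp
    have xA: "x \<in> A"
      unfolding A_def using X.subset_bipolar[of "{x}"] xX by simp
    have U: "U \<in> Obj C" and i: "incl A \<in> Hom C U X"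
      using subspace[OF X A] by (auto simp: U_def)
    have U_carrier: "carrier U = A"
      by (simp add: U_def sub_orthoset_def)
    have xU: "proper U x"
      using x xA by (simp add: U_def sub_orthoset_def proper_def)
    have generator: "\<not> orth U y x" if "proper U y" for y
      using that X.orth_generator_imp_zero[of y x]
      by (auto simp: U_def A_def sub_orthoset_def proper_def)
    have U_unital: "unital U"
      using xU generator by (auto simp: unital_def)

    obtain w0 where w0: "w0 \<in> Hom C U (sub_orthoset Z W)" "inj_on w0 (carrier U)"
      using unital_embedding[OF U U_unital _ W_unital] W_sub by blast
    define w where "w = Cmp C U (sub_orthoset Z W) Z (incl W) w0"
    have w: "w \<in> Hom C U Z"
      unfolding w_def using Cmp_in U W_sub Z w0(1) by blast
    have "w y = w0 y" if "y \<in> carrier U" for y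
      using Cmp_apply[of U "sub_orthoset Z W" Z w0 "incl W" y] U W_sub Z w0(1) that
        Hom_closed[of U "sub_orthoset Z W" w0 y]
      by (simp add: w_def incl_def sub_orthoset_def)
    then have w_inj: "inj_on w (carrier U)"
      using w0(2) by (simp cong: inj_on_cong)

    obtain d where d: "d \<in> Hom C U ?P"
      and d1: "Cmp C U ?P X (Dag C X ?P (Inl (S X))) d = incl A"
      and d2: "Cmp C U ?P Z (Dag C Z ?P (Inr (S X))) d = w"
      using pairing[OF SX U i w] by blast
    have dP: "d y \<in> carrier ?P" if "y \<in> carrier U" for y
      using Hom_closed[OF U P d that] .
    have d1_apply: "Dag C X ?P (Inl (S X)) (d x) = x"
      using Cmp_apply[OF U P X d Dag_in[OF X P Inl(1)], of x] d1 xA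
      by (simp add: U_carrier incl_def)
    have d2_apply: "Dag C Z ?P (Inr (S X)) (d y) = w y" if "y \<in> carrier U" for y
      using Cmp_apply[OF U P Z d Dag_in[OF Z P Inr(1)] that] d2 by simp

    let ?q = "Dag C Z ?Q (Inr (S Y))"
    let ?s = "Cmp C U ?P ?Q h d" and ?t = "Cmp C U ?P ?Q k d"
    have s_apply: "?s y = h (d y)" and t_apply: "?t y = k (d y)" if "y \<in> carrier U" for y
      using Cmp_apply[OF U P Q d _ that] h k by simp_all
    have component: "?q (?s y) = w y" "?q (?t y) = w y" if y: "y \<in> carrier U" for y
    proof -
      have "w y \<in> carrier Z"
        using Hom_closed[OF U Z w y] .
      then show "?q (?s y) = w y" "?q (?t y) = w y"
        using sum_morphism_components(2)[OF SX SY f Idt_in[OF Z] dP[OF y], folded h_def]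
          sum_morphism_components(2)[OF SX SY g Idt_in[OF Z] dP[OF y], folded k_def]
        by (simp_all add: s_apply[OF y] t_apply[OF y] d2_apply[OF y] Idt_eq[OF Z])
    qed
    have "?s = ?t"
    proof (rule projectively_equal_morphisms_agree[OF U xU generator Q Z, where q = ?q])
      show "?s \<in> Hom C U ?Q" "?t \<in> Hom C U ?Q" "?q \<in> Hom C ?Q Z"
        using Cmp_in[OF U P Q d] h k Dag_in[OF Z Q Inr(2)] by blast+
      show "parallel ?Q (?s x) (?t x)"
        using projective dP s_apply t_apply xA by (simp add: U_carrier)
      show "inj_on (\<lambda>y. ?q (?s y)) (carrier U)"
        using w_inj component(1) by (simp cong: inj_on_cong)
    qed (simp_all add: component)
    then have "h (d x) = k (d x)"
      using s_apply t_apply xA by (metis U_carrier)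
    then show "f x = g x"
      using sum_morphism_components(1)[OF SX SY f Idt_in[OF Z] dP[of x]]
        sum_morphism_components(1)[OF SX SY g Idt_in[OF Z] dP[of x]] xA d1_apply
      by (simp add: U_carrier h_def k_def)
  qed

  show ?thesis
    unfolding faithful_def
  proof (intro ballI inj_onI)
    fix X Y f g
    assume X: "X \<in> Obj C" and Y: "Y \<in> Obj C" and f: "f \<in> Hom C X Y" and g: "g \<in> Hom C X Y"
      and eq: "Fmor L X Y f = Fmor L X Y g"
    show "f = g"
    proof (rule Hom_eqI[OF X Y f g])
      fix x assume "x \<in> carrier X"
      then show "f x = g x"
        using agree[OF X Y f g eq, of x] Hom_zero[OF X Y f] Hom_zero[OF X Y g]
        by (cases "x = ozero X") (auto simp: proper_def)
    qed
  qed
qed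

end
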